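(* There do not exist coefficients $C_{lmn}\in\mathbb{C}$ ($l,m,n\in\mathbb{Z}$), not all zero, defining a product rule $(\phi\cdot\psi)_n=\sum_{l,m\in\mathbb{Z}}C_{lmn}\phi_l\psi_m$, and coefficients $D_{mn}\in\mathbb{C}$ ($m,n\in\mathbb{Z}$), not all zero and with $\sum_m D_{mn}=0$ for all $n$, defining a difference operator $(D\phi)_n=\sum_{m\in\mathbb{Z}}D_{mn}\phi_m$, that satisfy all four of the following properties: (i) (translation invariance) $C_{lmn}=C(l-n,m-n)$ and $D_{mn}=D(m-n)$ for functions $C:\mathbb{Z}^2\to\mathbb{C}$ and $D:\mathbb{Z}\to\mathbb{C}$; (ii) (locality) $C(k,l)$ and $D(m)$ decay exponentially; (iii) (Leibniz rule) $D(\phi\cdot\psi)=(D\phi)\cdot\psi+\phi\cdot(D\psi)$, i.e. for all $l,m,n\in\mathbb{Z}$, $\sum_k C_{lmk}D_{kn}=\sum_k C_{kmn}D_{lk}+\sum_k C_{lkn}D_{mk}$; (iv) (associative law) $(\phi\cdot\psi)\cdot\chi=\phi\cdot(\psi\cdot\chi)$, i.e. for all $l,m,n,k\in\mathbb{Z}$, $\sum_j C_{lmj}C_{jnk}=\sum_j C_{ljk}C_{mnj}$.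
   Context: The lattice is the infinite one-dimensional lattice $\mathbb{Z}$; a lattice field is a complex-valued function $\phi=(\phi_n)_{n\in\mathbb{Z}}$. Exponential decay means: there are constants $K,r>0$ with $|C(k,l)|\le K e^{-r(|k|+|l|)}$ for all $k,l\in\mathbb{Z}$ and $|D(m)|\le K e^{-r|m|}$ for all $m\in\mathbb{Z}$. (All sums in (iii) and (iv) then converge absolutely.) Equivalently, the functions $\hat C(v,w)=\sum_{k,l}C(k,l)v^kw^l$ and $\hat D(z)=\sum_m D(m)z^m$ are holomorphic on $\{1-\epsilon<|v|,|w|<1+\epsilon\}$ and $\{1-\epsilon<|z|<1+\epsilon\}$ respectively, for some $0<\epsilon<1$. A product rule is nontrivial if its coefficients are not all zero (equivalently $\hat C\not\equiv 0$). *)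

theory Defs
  imports "HOL-Analysis.Infinite_Sum"
begin

type_synonym lattice_field = "int \<Rightarrow> complex"

text \<open>
  A product rule is given by coefficients \<open>C l m n\<close> (standing for $C_{lmn}$), a difference
  operator by coefficients \<open>D m n\<close> (standing for $D_{mn}$); in both cases the last index is the
  output site.
\<close>

definition lattice_prod :: "(int \<Rightarrow> int \<Rightarrow> int \<Rightarrow> complex) \<Rightarrow> lattice_field \<Rightarrow> lattice_field \<Rightarrow> lattice_field" where
  "lattice_prod C \<phi> \<psi> = (\<lambda>n. \<Sum>\<^sub>\<infinity>(l, m)\<in>UNIV. C l m n * \<phi> l * \<psi> m)"

definition diff_op :: "(int \<Rightarrow> int \<Rightarrow> complex) \<Rightarrow> lattice_field \<Rightarrow> lattice_field" where
  "diff_op D \<phi> = (\<lambda>n. \<Sum>\<^sub>\<infinity>m\<in>UNIV. D m n * \<phi> m)"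

definition nontrivial_product :: "(int \<Rightarrow> int \<Rightarrow> int \<Rightarrow> complex) \<Rightarrow> bool" where
  "nontrivial_product C \<longleftrightarrow> (\<exists>l m n. C l m n \<noteq> 0)"

definition nontrivial_difference :: "(int \<Rightarrow> int \<Rightarrow> complex) \<Rightarrow> bool" where
  "nontrivial_difference D \<longleftrightarrow> (\<exists>m n. D m n \<noteq> 0)"

definition annihilates_constants :: "(int \<Rightarrow> int \<Rightarrow> complex) \<Rightarrow> bool" where
  "annihilates_constants D \<longleftrightarrow> (\<forall>n. ((\<lambda>m. D m n) has_sum 0) UNIV)"

definition translation_invariant ::
  "(int \<Rightarrow> int \<Rightarrow> int \<Rightarrow> complex) \<Rightarrow> (int \<Rightarrow> int \<Rightarrow> complex) \<Rightarrow>
   (int \<Rightarrow> int \<Rightarrow> complex) \<Rightarrow> (int \<Rightarrow> complex) \<Rightarrow> bool" where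
  "translation_invariant C D c d \<longleftrightarrow>
     (\<forall>l m n. C l m n = c (l - n) (m - n)) \<and> (\<forall>m n. D m n = d (m - n))"

definition exponential_decay :: "(int \<Rightarrow> int \<Rightarrow> complex) \<Rightarrow> (int \<Rightarrow> complex) \<Rightarrow> bool" where
  "exponential_decay c d \<longleftrightarrow>
     (\<exists>K r :: real. K > 0 \<and> r > 0 \<and>
        (\<forall>k l. norm (c k l) \<le> K * exp (- r * real_of_int (\<bar>k\<bar> + \<bar>l\<bar>))) \<and>
        (\<forall>m. norm (d m) \<le> K * exp (- r * real_of_int \<bar>m\<bar>)))"

text \<open>
  The Leibniz rule and the associative law are identities between coefficients. The operation
  \<open>\<Sum>\<^sub>\<infinity>\<close> returns 0 on families that are not summable; for translation invariant coefficients
  with exponential decay every sum below converges absolutely.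
\<close>

definition leibniz_rule ::
  "(int \<Rightarrow> int \<Rightarrow> int \<Rightarrow> complex) \<Rightarrow> (int \<Rightarrow> int \<Rightarrow> complex) \<Rightarrow> bool" where
  "leibniz_rule C D \<longleftrightarrow>
     (\<forall>l m n. (\<Sum>\<^sub>\<infinity>k\<in>UNIV. C l m k * D k n) =
        (\<Sum>\<^sub>\<infinity>k\<in>UNIV. C k m n * D l k) + (\<Sum>\<^sub>\<infinity>k\<in>UNIV. C l k n * D m k))"

definition associative_law :: "(int \<Rightarrow> int \<Rightarrow> int \<Rightarrow> complex) \<Rightarrow> bool" where
  "associative_law C \<longleftrightarrow>
     (\<forall>l m n k. (\<Sum>\<^sub>\<infinity>j\<in>UNIV. C l m j * C j n k) = (\<Sum>\<^sub>\<infinity>j\<in>UNIV. C l j k * C m n j))"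

text \<open>On the unit fields the two laws are the ones for the operations on fields.\<close>

definition unit_field :: "int \<Rightarrow> lattice_field" where
  "unit_field a = (\<lambda>n. if n = a then 1 else 0)"

lemma infsum_unit: "(\<Sum>\<^sub>\<infinity>k\<in>UNIV. f k * unit_field a k) = f a"
proof -
  have "(\<Sum>\<^sub>\<infinity>k\<in>UNIV. f k * unit_field a k) = (\<Sum>\<^sub>\<infinity>k\<in>{a}. f k)"
    by (rule infsum_cong_neutral) (auto simp: unit_field_def)
  then show ?thesis by simp
qed

lemma diff_op_unit: "diff_op D (unit_field m) = D m"
  by (simp add: diff_op_def infsum_unit)

lemma lattice_prod_unit_right:
  "lattice_prod C \<phi> (unit_field m) = (\<lambda>n. \<Sum>\<^sub>\<infinity>k\<in>UNIV. C k m n * \<phi> k)"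
proof
  fix n
  have "lattice_prod C \<phi> (unit_field m) n =
      (\<Sum>\<^sub>\<infinity>p\<in>(\<lambda>k. (k, m)) ` UNIV. case p of (k, j) \<Rightarrow> C k j n * \<phi> k)"
    unfolding lattice_prod_def
    by (rule infsum_cong_neutral) (auto simp: unit_field_def)
  also have "\<dots> = (\<Sum>\<^sub>\<infinity>k\<in>UNIV. C k m n * \<phi> k)"
    by (subst infsum_reindex) (auto simp: inj_on_def o_def)
  finally show "lattice_prod C \<phi> (unit_field m) n = (\<Sum>\<^sub>\<infinity>k\<in>UNIV. C k m n * \<phi> k)" .
qed

lemma lattice_prod_unit_left:
  "lattice_prod C (unit_field l) \<psi> = (\<lambda>n. \<Sum>\<^sub>\<infinity>k\<in>UNIV. C l k n * \<psi> k)"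
proof
  fix n
  have "lattice_prod C (unit_field l) \<psi> n =
      (\<Sum>\<^sub>\<infinity>p\<in>(\<lambda>k. (l, k)) ` UNIV. case p of (j, k) \<Rightarrow> C j k n * \<psi> k)"
    unfolding lattice_prod_def
    by (rule infsum_cong_neutral) (auto simp: unit_field_def)
  also have "\<dots> = (\<Sum>\<^sub>\<infinity>k\<in>UNIV. C l k n * \<psi> k)"
    by (subst infsum_reindex) (auto simp: inj_on_def o_def)
  finally show "lattice_prod C (unit_field l) \<psi> n = (\<Sum>\<^sub>\<infinity>k\<in>UNIV. C l k n * \<psi> k)" .
qed

lemma lattice_prod_units: "lattice_prod C (unit_field l) (unit_field m) = C l m"
  by (simp add: lattice_prod_unit_left infsum_unit)

lemma leibniz_rule_iff_units:
  "leibniz_rule C D \<longleftrightarrow>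
     (\<forall>l m. diff_op D (lattice_prod C (unit_field l) (unit_field m)) =
        (\<lambda>n. lattice_prod C (diff_op D (unit_field l)) (unit_field m) n +
             lattice_prod C (unit_field l) (diff_op D (unit_field m)) n))"
  unfolding diff_op_unit lattice_prod_units unfolding lattice_prod_unit_left lattice_prod_unit_right
  by (simp add: leibniz_rule_def diff_op_def fun_eq_iff mult.commute)

lemma associative_law_iff_units:
  "associative_law C \<longleftrightarrow>
     (\<forall>l m n. lattice_prod C (lattice_prod C (unit_field l) (unit_field m)) (unit_field n) =
        lattice_prod C (unit_field l) (lattice_prod C (unit_field m) (unit_field n)))"
  unfolding lattice_prod_units unfolding lattice_prod_unit_left lattice_prod_unit_right
  by (simp add: associative_law_def fun_eq_iff infsum_unit mult.commute)

end

theory Submission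
  imports Defs "HOL-Complex_Analysis.Complex_Analysis"
begin

text \<open>
  Passing to Fourier series, translation invariance turns the Leibniz rule into
  \<open>c^(s, t) (d^(s + t) - d^(s) - d^(t)) = 0\<close> for real \<open>s, t\<close>. For fixed \<open>t\<close> both factors are
  restrictions of holomorphic functions of \<open>s\<close> on a strip around the real axis, by exponential
  decay, so one of them vanishes identically. If it is the second one, comparing coefficients gives
  \<open>d m (exp (i m t) - 1) = 0\<close> for all \<open>m \<noteq> 0\<close>. Hence, if some \<open>d m\<close> with \<open>m \<noteq> 0\<close> is nonzero, the first factor
  vanishes for every \<open>t\<close> with \<open>exp (i m t) \<noteq> 1\<close>, and the same zero divisor argument in the variable \<open>t\<close>
  yields \<open>c = 0\<close>. Otherwise \<open>d\<close> is supported at 0, and annihilating constants forces \<open>d = 0\<close>.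
\<close>

section \<open>Exponentially decaying sequences and their Fourier series\<close>

definition exp_decaying :: "(int \<Rightarrow> complex) \<Rightarrow> bool" where
  "exp_decaying a \<longleftrightarrow> (\<exists>K r :: real. r > 0 \<and> (\<forall>m. norm (a m) \<le> K * exp (- r * real_of_int \<bar>m\<bar>)))"

text \<open>The argument is complex so that the series can be continued off the real axis. For
  exponentially decaying coefficients it converges in a strip; where it fails to converge the value
  is 0 by default, so only values in such a strip carry meaning.\<close>

definition fourier_series :: "(int \<Rightarrow> complex) \<Rightarrow> complex \<Rightarrow> complex" where
  "fourier_series a z = (\<Sum>\<^sub>\<infinity>m\<in>UNIV. a m * exp (\<i> * of_int m * z))"

lemma exp_decaying_dominated:
  assumes "exp_decaying a" and "\<And>m. norm (b m) \<le> B * norm (a m)"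
  shows "exp_decaying b"
proof -
  obtain K r where r: "r > 0" and K: "\<And>m. norm (a m) \<le> K * exp (- r * real_of_int \<bar>m\<bar>)"
    using assms(1) by (auto simp: exp_decaying_def)
  \<comment> \<open>The sign of \<open>B\<close> is not known, hence the absolute value in the
    constant.\<close>
  have "norm (b m) \<le> \<bar>B\<bar> * K * exp (- r * real_of_int \<bar>m\<bar>)" for m
  proof -
    have "norm (b m) \<le> \<bar>B\<bar> * norm (a m)"
      using assms(2)[of m] by (meson abs_ge_self mult_right_mono norm_ge_zero order_trans)
    also have "\<dots> \<le> \<bar>B\<bar> * (K * exp (- r * real_of_int \<bar>m\<bar>))"
      by (intro mult_left_mono K) auto
    finally show ?thesis by (simp add: mult.assoc)
  qed
  with r show ?thesis
    unfolding exp_decaying_def by blast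
qed

lemma exp_decaying_finite_support:
  assumes "\<And>m. \<bar>m\<bar> > N \<Longrightarrow> a m = 0"
  shows "exp_decaying a"
proof -
  \<comment> \<open>The decay rate will be 1. The factor \<open>exp N\<close> compensates for
    \<open>exp (- \<bar>m\<bar>)\<close>, which is at least \<open>exp (- N)\<close> on the
    support.\<close>
  define K where "K = (\<Sum>m\<in>{-N..N}. norm (a m)) * exp (real_of_int N)"
  have "norm (a m) \<le> K * exp (- 1 * real_of_int \<bar>m\<bar>)" for m
  proof (cases "\<bar>m\<bar> > N")
    case True
    then show ?thesis
      using assms[of m] by (simp add: K_def sum_nonneg)
  next
    case False
    have "norm (a m) \<le> (\<Sum>m\<in>{-N..N}. norm (a m))"
      by (rule member_le_sum) (use False in auto)
    also have "\<dots> = (\<Sum>m\<in>{-N..N}. norm (a m)) * 1"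
      by simp
    also have "\<dots> \<le> (\<Sum>m\<in>{-N..N}. norm (a m)) * exp (real_of_int N - real_of_int \<bar>m\<bar>)"
    proof (rule mult_left_mono)
      have "real_of_int \<bar>m\<bar> \<le> real_of_int N"
        using False by (simp only: of_int_le_iff not_less)
      then show "1 \<le> exp (real_of_int N - real_of_int \<bar>m\<bar>)"
        by simp
    qed (auto simp: sum_nonneg)
    finally show ?thesis by (simp add: K_def exp_diff exp_minus field_simps)
  qed
  then show ?thesis
    unfolding exp_decaying_def by (intro exI[of _ K] exI[of _ 1]) auto
qed

lemma exp_decaying_diff:
  assumes "exp_decaying a" "exp_decaying b"
  shows "exp_decaying (\<lambda>m. a m - b m)"
proof -
  obtain K r where r: "r > 0" and K: "\<And>m. norm (a m) \<le> K * exp (- r * real_of_int \<bar>m\<bar>)"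
    using assms(1) by (auto simp: exp_decaying_def)
  obtain L s where s: "s > 0" and L: "\<And>m. norm (b m) \<le> L * exp (- s * real_of_int \<bar>m\<bar>)"
    using assms(2) by (auto simp: exp_decaying_def)
  define t where "t = min r s"
  \<comment> \<open>Nonnegative constants, read off at index 0, are what permits weakening both
    rates to their minimum.\<close>
  have "K \<ge> 0" "L \<ge> 0"
    using K[of 0] L[of 0] by (auto intro: order_trans[OF norm_ge_zero])
  have "norm (a m - b m) \<le> (K + L) * exp (- t * real_of_int \<bar>m\<bar>)" for m
  proof -
    have "norm (a m - b m) \<le> norm (a m) + norm (b m)"
      by (rule norm_triangle_ineq4)
    also have "\<dots> \<le> K * exp (- r * real_of_int \<bar>m\<bar>) + L * exp (- s * real_of_int \<bar>m\<bar>)"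
      by (intro add_mono K L)
    also have "\<dots> \<le> K * exp (- t * real_of_int \<bar>m\<bar>) + L * exp (- t * real_of_int \<bar>m\<bar>)"
      using \<open>K \<ge> 0\<close> \<open>L \<ge> 0\<close>
      by (intro add_mono mult_left_mono) (auto simp: t_def intro!: mult_right_mono)
    finally show ?thesis by (simp add: algebra_simps)
  qed
  moreover have "t > 0" using r s by (simp add: t_def)
  ultimately show ?thesis
    unfolding exp_decaying_def by blast
qed

text \<open>Two geometric series, one over each half of the integers. The halves share 0, which does
  no harm since only summability is claimed.\<close>

lemma summable_on_exp_neg_abs:
  assumes "r > 0"
  shows "(\<lambda>m::int. exp (- r * real_of_int \<bar>m\<bar>)) summable_on UNIV"
proof -
  let ?f = "\<lambda>m::int. exp (- r * real_of_int \<bar>m\<bar>)"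
  have geo: "(\<lambda>n. exp (- r * real n)) summable_on UNIV"
  proof (rule norm_summable_imp_summable_on)
    have "summable (\<lambda>n. exp (- r) ^ n)"
      using assms by (intro summable_geometric) auto
    then show "summable (\<lambda>n. norm (exp (- r * real n)))"
      by (simp add: exp_of_nat_mult[symmetric] mult.commute)
  qed
  have "?f summable_on range int"
    by (subst summable_on_reindex) (use geo in \<open>auto simp: o_def\<close>)
  moreover have "?f summable_on range (\<lambda>n. - int n)"
    by (subst summable_on_reindex) (use geo in \<open>auto simp: o_def inj_on_def\<close>)
  moreover have "m \<in> range int \<union> range (\<lambda>n. - int n)" for m
    by (cases m rule: int_cases2) auto
  then have "range int \<union> range (\<lambda>n. - int n) = UNIV"
    by blast
  ultimately show ?thesis
    using summable_on_union by metis
qed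

lemma fourier_term_summable:
  assumes "exp_decaying a"
  shows "(\<lambda>m. a m * exp (\<i> * of_int m * of_real t)) summable_on UNIV"
proof -
  obtain K r where r: "r > 0" and K: "\<And>m. norm (a m) \<le> K * exp (- r * real_of_int \<bar>m\<bar>)"
    using assms by (auto simp: exp_decaying_def)
  have "(\<lambda>m. K * exp (- r * real_of_int \<bar>m\<bar>)) summable_on UNIV"
    using summable_on_exp_neg_abs[OF r] by (rule summable_on_cmult_right)
  then have "(\<lambda>m. norm (a m * exp (\<i> * of_int m * of_real t))) summable_on UNIV"
    by (rule Infinite_Sum.abs_summable_on_comparison_test') (use K in \<open>simp add: norm_mult\<close>)
  then show ?thesis
    by (simp add: summable_on_iff_abs_summable_on_complex)
qed

lemma exp_decaying_summable:
  assumes "exp_decaying a"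
  shows "a summable_on UNIV"
  using fourier_term_summable[OF assms, of 0] by simp

text \<open>Half of the decay rate is given up: for \<open>\<bar>Im z\<bar> < r / 2\<close> the
  exponential grows at most like \<open>exp (\<bar>m\<bar> * r / 2)\<close>, which leaves a summable
  majorant of rate \<open>r / 2\<close>. The partial sums are entire and converge uniformly on the
  strip.\<close>

lemma fourier_series_holomorphic:
  assumes r: "r > 0" and K: "\<And>m. norm (a m) \<le> K * exp (- r * real_of_int \<bar>m\<bar>)"
  shows "fourier_series a holomorphic_on {z. \<bar>Im z\<bar> < r / 2}"
proof -
  let ?S = "{z. \<bar>Im z\<bar> < r / 2}"
  have "open ?S"
    by (intro open_Collect_less continuous_intros)
  have "K \<ge> 0"
    using K[of 0] by (auto intro: order_trans[OF norm_ge_zero])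
  have ul: "uniform_limit ?S (\<lambda>X z. \<Sum>m\<in>X. a m * exp (\<i> * of_int m * z)) (fourier_series a)
      (finite_subsets_at_top UNIV)"
    unfolding fourier_series_def
  proof (rule Weierstrass_m_test_general)
    show "(\<lambda>m. K * exp (- (r / 2) * real_of_int \<bar>m\<bar>)) summable_on UNIV"
      by (intro summable_on_cmult_right summable_on_exp_neg_abs) (use r in auto)
    fix m :: int and z assume z: "z \<in> ?S"
    have "- (real_of_int m * Im z) \<le> real_of_int \<bar>m\<bar> * \<bar>Im z\<bar>"
      by (metis abs_ge_minus_self abs_mult of_int_abs)
    also have "\<dots> \<le> real_of_int \<bar>m\<bar> * (r / 2)"
      using z by (intro mult_left_mono) auto
    finally have *: "- (real_of_int m * Im z) \<le> real_of_int \<bar>m\<bar> * (r / 2)" .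
    have "norm (a m * exp (\<i> * of_int m * z)) = norm (a m) * exp (- (real_of_int m * Im z))"
      by (simp add: norm_mult)
    also have "\<dots> \<le> (K * exp (- r * real_of_int \<bar>m\<bar>)) * exp (real_of_int \<bar>m\<bar> * (r / 2))"
      by (intro mult_mono K) (use * \<open>K \<ge> 0\<close> in auto)
    also have "\<dots> = K * exp (- (r / 2) * real_of_int \<bar>m\<bar>)"
      by (simp add: mult.assoc field_simps flip: exp_add)
    finally show "norm (a m * exp (\<i> * of_int m * z)) \<le> K * exp (- (r / 2) * real_of_int \<bar>m\<bar>)" .
  qed
  have "\<exists>e>0. fourier_series a holomorphic_on ball z e" if z: "z \<in> ?S" for z
  proof -
    obtain e where e: "e > 0" "cball z e \<subseteq> ?S"
      using open_contains_cball_eq[OF \<open>open ?S\<close>] z by blast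
    have "fourier_series a holomorphic_on ball z e"
    proof (rule holomorphic_uniform_limit[OF _ uniform_limit_on_subset[OF ul e(2)]])
      show "\<forall>\<^sub>F X in finite_subsets_at_top UNIV.
          continuous_on (cball z e) (\<lambda>z. \<Sum>m\<in>X. a m * exp (\<i> * of_int m * z)) \<and>
          (\<lambda>z. \<Sum>m\<in>X. a m * exp (\<i> * of_int m * z)) holomorphic_on ball z e"
        by (intro always_eventually allI conjI continuous_intros holomorphic_intros)
    qed simp_all
    with e show ?thesis by blast
  qed
  then show ?thesis
    by (metis (no_types, lifting) \<open>open ?S\<close> analytic_on_def analytic_on_open)
qed

section \<open>Uniqueness of coefficients and absence of zero divisors\<close>

lemma has_integral_exp_i_int:
  "((\<lambda>t. exp (\<i> * of_int k * of_real t)) has_integral (if k = 0 then 2 * pi else 0)) {0..2 * pi}"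
proof (cases "k = 0")
  case True
  then show ?thesis
    using has_integral_const_real[of "1::complex" 0 "2 * pi"] by (simp add: scaleR_conv_of_real)
next
  case False
  let ?F = "\<lambda>t. exp (\<i> * of_int k * of_real t) / (\<i> * of_int k)"
  have "((\<lambda>t. exp (\<i> * of_int k * of_real t)) has_integral ?F (2 * pi) - ?F 0) {0..2 * pi}"
  proof (rule fundamental_theorem_of_calculus)
    fix t :: real
    have "((\<lambda>z. exp (\<i> * of_int k * z) / (\<i> * of_int k)) has_field_derivative
        exp (\<i> * of_int k * of_real t)) (at (of_real t))"
      by (auto intro!: derivative_eq_intros simp: False)
    then show "(?F has_vector_derivative exp (\<i> * of_int k * of_real t)) (at t within {0..2 * pi})"
      by (rule has_vector_derivative_at_within[OF has_vector_derivative_real_field])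
  qed auto
  moreover have "exp (\<i> * of_int k * of_real (2 * pi)) = 1"
    using exp_integer_2pi[of "of_int k"] by (simp add: mult_ac)
  ultimately show ?thesis
    using False by simp
qed

text \<open>Multiply the series by \<open>exp (- \<i> * of_int m * t)\<close> and integrate termwise
  over a period. Uniform convergence justifies this, and orthogonality leaves
  \<open>2 * pi * a m\<close>.\<close>

lemma fourier_series_eq_0_imp:
  assumes a: "exp_decaying a" and zero: "\<And>t::real. fourier_series a (of_real t) = 0"
  shows "a m = 0"
proof -
  let ?f = "\<lambda>X t. \<Sum>n\<in>X. a n * exp (\<i> * of_int (n - m) * of_real t)"
  have exp_eq: "exp (\<i> * of_int (n - m) * of_real t) =
      exp (\<i> * of_int n * of_real t) * exp (- \<i> * of_int m * of_real t)" for n and t :: real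
    by (simp add: algebra_simps flip: exp_add)
  have sum0: "(\<Sum>\<^sub>\<infinity>n. a n * exp (\<i> * of_int (n - m) * of_real t)) = 0" for t :: real
    unfolding exp_eq mult.assoc[symmetric]
    by (subst infsum_cmult_left) (use zero[of t] fourier_term_summable[OF a] in
        \<open>auto simp: fourier_series_def\<close>)
  have "uniform_limit {0..2 * pi} ?f (\<lambda>t. \<Sum>\<^sub>\<infinity>n. a n * exp (\<i> * of_int (n - m) * of_real t))
      (finite_subsets_at_top UNIV)"
    by (rule Weierstrass_m_test_general[where M = "\<lambda>n. norm (a n)"])
      (use exp_decaying_summable[OF a] in
        \<open>auto simp: norm_mult simp flip: summable_on_iff_abs_summable_on_complex\<close>)
  then have "uniform_limit {0..2 * pi} ?f (\<lambda>t. 0) (finite_subsets_at_top UNIV)"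
    by (simp only: sum0)
  \<comment> \<open>\<open>I X\<close> is the integral of the partial sum over \<open>X\<close>, and
    \<open>J\<close> that of the limit function 0. The rest computes \<open>I X\<close> for finite
    \<open>X\<close> containing \<open>m\<close>, that is, eventually along the net.\<close>
  then obtain I J where I: "\<And>X. (?f X has_integral I X) {0..2 * pi}"
    and J: "((\<lambda>t. 0 :: complex) has_integral J) {0..2 * pi}"
    and lim: "(I \<longlongrightarrow> J) (finite_subsets_at_top UNIV)"
    by (rule uniform_limit_integral) (auto intro!: continuous_intros)
  have "J = 0"
    using J by (simp add: has_integral_0_eq)
  have "I X = 2 * pi * a m" if "finite X" "m \<in> X" for X
  proof -
    have "(?f X has_integral (\<Sum>n\<in>X. a n * (if n - m = 0 then 2 * pi else 0))) {0..2 * pi}"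
      by (intro has_integral_sum has_integral_mult_right has_integral_exp_i_int that)
    moreover have "(\<Sum>n\<in>X. a n * (if n - m = 0 then 2 * pi else 0)) = 2 * pi * a m"
    proof -
      have "(\<Sum>n\<in>X. a n * (if n - m = 0 then 2 * pi else 0)) =
          (\<Sum>n\<in>X. if n = m then 2 * pi * a m else 0)"
        by (intro sum.cong) auto
      then show ?thesis using that by simp
    qed
    ultimately show ?thesis
      using has_integral_unique[OF I] by simp
  qed
  then have "eventually (\<lambda>X. I X = 2 * pi * a m) (finite_subsets_at_top UNIV)"
    unfolding eventually_finite_subsets_at_top by (intro exI[of _ "{m}"]) auto
  then have "(I \<longlongrightarrow> 2 * pi * a m) (finite_subsets_at_top UNIV)"
    by (rule tendsto_eventually)
  with lim \<open>J = 0\<close> have "2 * pi * a m = 0"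
    using tendsto_unique[OF finite_subsets_at_top_neq_bot] by blast
  then show ?thesis by simp
qed

text \<open>If \<open>b\<close> is not zero, its series is nonzero at some real point and, by
  continuity, on an interval. There the series of \<open>a\<close> vanishes; the identity theorem
  carries this to the whole strip, and uniqueness of coefficients gives
  \<open>a = 0\<close>.\<close>

lemma fourier_series_no_zero_divisors:
  assumes a: "exp_decaying a" and b: "exp_decaying b"
    and zero: "\<And>t::real. fourier_series a (of_real t) * fourier_series b (of_real t) = 0"
  shows "(\<forall>m. a m = 0) \<or> (\<forall>m. b m = 0)"
proof (rule disjCI)
  assume "\<not> (\<forall>m. b m = 0)"
  then obtain t0 :: real where t0: "fourier_series b (of_real t0) \<noteq> 0"
    using fourier_series_eq_0_imp[OF b] by blast
  obtain K r where r: "r > 0" and K: "\<And>m. norm (a m) \<le> K * exp (- r * real_of_int \<bar>m\<bar>)"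
    using a by (auto simp: exp_decaying_def)
  obtain L s where s: "s > 0" and L: "\<And>m. norm (b m) \<le> L * exp (- s * real_of_int \<bar>m\<bar>)"
    using b by (auto simp: exp_decaying_def)
  let ?S = "{z. \<bar>Im z\<bar> < r / 2}"
  have "continuous_on UNIV (\<lambda>t::real. fourier_series b (of_real t))"
    by (rule continuous_on_compose2[OF holomorphic_on_imp_continuous_on
          [OF fourier_series_holomorphic[OF s L]]]) (use s in \<open>auto intro!: continuous_intros\<close>)
  then have "open {t::real. fourier_series b (of_real t) \<noteq> 0}"
    by (intro open_Collect_neq continuous_on_const)
  then obtain e where e: "e > 0" "\<And>t. t \<in> ball t0 e \<Longrightarrow> fourier_series b (of_real t) \<noteq> 0"
    unfolding open_contains_ball using t0 by blast
  have "fourier_series a w = 0" if "w \<in> ?S" for w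
  proof (rule analytic_continuation[OF fourier_series_holomorphic[OF r K]])
    show "open ?S"
      by (intro open_Collect_less continuous_intros)
    have "?S = {z. Im z < r / 2} \<inter> {z. Im z > - (r / 2)}"
      by (auto simp: abs_less_iff)
    then show "connected ?S"
      by (metis convex_Int convex_connected convex_halfspace_Im_gt convex_halfspace_Im_lt)
    show "of_real ` ball t0 e \<subseteq> ?S" "of_real t0 \<in> ?S" "w \<in> ?S"
      using r that by auto
    \<comment> \<open>The identity theorem only asks for zeros accumulating at a point of the strip,
      so a real interval is enough.\<close>
    have "t0 islimpt ball t0 e"
      using e(1) by (intro interior_limit_point) auto
    then show "of_real t0 islimpt (of_real :: real \<Rightarrow> complex) ` ball t0 e"
      by (rule islimpt_isCont_image) (auto simp: eventually_at_filter)
    show "fourier_series a z = 0" if "z \<in> of_real ` ball t0 e" for z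
      using that zero e(2) by fastforce
  qed
  then show "\<forall>m. a m = 0"
    using fourier_series_eq_0_imp[OF a] r by simp
qed

section \<open>Products of infinite sums and iterated summation\<close>

lemma summable_on_Times_mult:
  fixes f :: "'a \<Rightarrow> complex" and g :: "'b \<Rightarrow> complex"
  assumes "f summable_on A" "g summable_on B"
  shows "(\<lambda>(x, y). f x * g y) summable_on A \<times> B"
proof -
  \<comment> \<open>Summability and absolute summability agree for complex families, so the
    criterion for iterated sums of norms applies, and those sums factor.\<close>
  have "(\<lambda>x. norm (f x)) summable_on A" "(\<lambda>y. norm (g y)) summable_on B"
    using assms by (auto simp: summable_on_iff_abs_summable_on_complex)
  then have "(\<lambda>p. norm (case p of (x, y) \<Rightarrow> f x * g y)) summable_on A \<times> B"
    unfolding Infinite_Sum.abs_summable_on_Sigma_iff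
    by (simp add: norm_mult infsum_cmult_right' infsum_nonneg summable_on_cmult_right
        summable_on_cmult_left)
  then show ?thesis
    by (simp add: summable_on_iff_abs_summable_on_complex)
qed

lemma has_sum_Times_mult:
  fixes f :: "'a \<Rightarrow> complex" and g :: "'b \<Rightarrow> complex"
  assumes "(f has_sum s) A" "(g has_sum t) B"
  shows "((\<lambda>(x, y). f x * g y) has_sum s * t) (A \<times> B)"
proof (rule has_sum_SigmaI)
  show "((\<lambda>x. f x * t) has_sum s * t) A"
    using assms(1) by (rule has_sum_cmult_left)
  show "((\<lambda>y. case (x, y) of (x, y) \<Rightarrow> f x * g y) has_sum f x * t) B" for x
    using assms(2) by (auto intro: has_sum_cmult_right)
  show "(\<lambda>(x, y). f x * g y) summable_on A \<times> B"
    using assms by (intro summable_on_Times_mult) (auto simp: summable_on_def)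
qed

lemma has_sum_Times_infsum:
  fixes f :: "'a \<times> 'b \<Rightarrow> complex"
  assumes "(f has_sum s) (A \<times> B)"
  shows "((\<lambda>x. \<Sum>\<^sub>\<infinity>y\<in>B. f (x, y)) has_sum s) A"
proof (rule has_sum_SigmaD[OF assms])
  fix x assume "x \<in> A"
  moreover have "(\<lambda>(x, y). f (x, y)) summable_on A \<times> B"
    using assms by (simp add: has_sum_imp_summable)
  ultimately have "(\<lambda>y. f (x, y)) summable_on B"
    by (rule summable_on_SigmaD1[rotated])
  then show "((\<lambda>y. f (x, y)) has_sum (\<Sum>\<^sub>\<infinity>y\<in>B. f (x, y))) B"
    by (rule has_sum_infsum)
qed

section \<open>Two-variable Fourier series and the Leibniz rule\<close>

lemma fourier_series_has_sum:
  assumes "exp_decaying a"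
  shows "((\<lambda>m. a m * exp (\<i> * of_int m * of_real t)) has_sum fourier_series a (of_real t)) UNIV"
  unfolding fourier_series_def by (intro has_sum_infsum fourier_term_summable assms)

text \<open>A single sum over pairs rather than an iterated one, which leaves the indices free for
  substitutions. Real arguments suffice, since holomorphy is only used in one variable at a
  time.\<close>

definition double_fourier :: "(int \<Rightarrow> int \<Rightarrow> complex) \<Rightarrow> real \<Rightarrow> real \<Rightarrow> complex" where
  "double_fourier c s t = (\<Sum>\<^sub>\<infinity>(p, q)\<in>UNIV \<times> UNIV.
     c p q * (exp (\<i> * of_int p * of_real s) * exp (\<i> * of_int q * of_real t)))"

context
  fixes c :: "int \<Rightarrow> int \<Rightarrow> complex" and K r :: real
  assumes r: "r > 0"
    and c_le: "\<And>k l. norm (c k l) \<le> K * exp (- r * real_of_int (\<bar>k\<bar> + \<bar>l\<bar>))"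
begin

lemma c_le_mult: "norm (c k l) \<le> K * exp (- r * real_of_int \<bar>k\<bar>) * exp (- r * real_of_int \<bar>l\<bar>)"
  using c_le[of k l] by (simp add: mult.assoc ring_distribs flip: exp_add)

lemma exp_decaying_section: "exp_decaying (c k)"
  unfolding exp_decaying_def using c_le_mult r by blast

lemma double_fourier_has_sum:
  "((\<lambda>(p, q). c p q * (exp (\<i> * of_int p * of_real s) * exp (\<i> * of_int q * of_real t)))
     has_sum double_fourier c s t) (UNIV \<times> UNIV)"
  unfolding double_fourier_def
proof (rule has_sum_infsum)
  let ?e = "\<lambda>m::int. exp (- r * real_of_int \<bar>m\<bar>)"
  \<comment> \<open>The majorant is a product of two real sequences; it is cast to the complex
    numbers to fit \<open>summable_on_Times_mult\<close>.\<close>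
  have "(\<lambda>m. complex_of_real (?e m)) summable_on UNIV"
    by (intro summable_on_of_real summable_on_exp_neg_abs r)
  then have "(\<lambda>(p, q). complex_of_real (?e p) * complex_of_real (?e q)) summable_on UNIV \<times> UNIV"
    by (intro summable_on_Times_mult)
  then have "(\<lambda>x. norm (case x of (p, q) \<Rightarrow> complex_of_real (?e p) * complex_of_real (?e q)))
      summable_on UNIV \<times> UNIV"
    by (simp only: summable_on_iff_abs_summable_on_complex)
  then have "(\<lambda>x. K * norm (case x of (p, q) \<Rightarrow> complex_of_real (?e p) * complex_of_real (?e q)))
      summable_on UNIV \<times> UNIV"
    by (rule summable_on_cmult_right)
  then have "(\<lambda>x. norm (case x of (p, q) \<Rightarrow>
      c p q * (exp (\<i> * of_int p * of_real s) * exp (\<i> * of_int q * of_real t)))) summable_on UNIV \<times> UNIV"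
    by (rule Infinite_Sum.abs_summable_on_comparison_test')
      (use c_le_mult in \<open>auto simp: norm_mult mult.assoc\<close>)
  then show "(\<lambda>(p, q). c p q * (exp (\<i> * of_int p * of_real s) * exp (\<i> * of_int q * of_real t)))
      summable_on UNIV \<times> UNIV"
    by (simp only: summable_on_iff_abs_summable_on_complex)
qed

text \<open>Summing the majorant over \<open>q\<close> leaves the decay in \<open>p\<close> intact,
  with a constant independent of \<open>t\<close>. Thus for fixed \<open>t\<close> the one-variable
  results apply in \<open>s\<close>.\<close>

lemma exp_decaying_partial_fourier: "exp_decaying (\<lambda>p. fourier_series (c p) (of_real t))"
proof -
  define M where "M = (\<Sum>\<^sub>\<infinity>q::int. exp (- r * real_of_int \<bar>q\<bar>))"
  have "norm (fourier_series (c p) (of_real t)) \<le> K * M * exp (- r * real_of_int \<bar>p\<bar>)" for p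
  proof -
    have "((\<lambda>q::int. K * exp (- r * real_of_int \<bar>p\<bar>) * exp (- r * real_of_int \<bar>q\<bar>))
        has_sum K * exp (- r * real_of_int \<bar>p\<bar>) * M) UNIV"
      unfolding M_def by (intro has_sum_cmult_right has_sum_infsum summable_on_exp_neg_abs r)
    then have "norm (fourier_series (c p) (of_real t)) \<le> K * exp (- r * real_of_int \<bar>p\<bar>) * M"
      by (rule norm_infsum_le[OF fourier_series_has_sum[OF exp_decaying_section]])
        (use c_le_mult in \<open>simp add: norm_mult\<close>)
    then show ?thesis by (simp add: mult_ac)
  qed
  with r show ?thesis
    unfolding exp_decaying_def by blast
qed

lemma double_fourier_eq:
  "double_fourier c s t = fourier_series (\<lambda>p. fourier_series (c p) (of_real t)) (of_real s)"
proof -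
  have "((\<lambda>p. \<Sum>\<^sub>\<infinity>q. c p q * (exp (\<i> * of_int p * of_real s) * exp (\<i> * of_int q * of_real t)))
      has_sum double_fourier c s t) UNIV"
    using has_sum_Times_infsum[OF double_fourier_has_sum] by simp
  moreover have "(\<Sum>\<^sub>\<infinity>q. c p q * (exp (\<i> * of_int p * of_real s) * exp (\<i> * of_int q * of_real t))) =
      fourier_series (c p) (of_real t) * exp (\<i> * of_int p * of_real s)" for p
  proof -
    have "(\<Sum>\<^sub>\<infinity>q. c p q * (exp (\<i> * of_int p * of_real s) * exp (\<i> * of_int q * of_real t))) =
        (\<Sum>\<^sub>\<infinity>q. c p q * exp (\<i> * of_int q * of_real t) * exp (\<i> * of_int p * of_real s))"
      by (intro infsum_cong) (simp only: mult_ac)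
    then show ?thesis
      unfolding fourier_series_def by (simp only: infsum_cmult_left')
  qed
  ultimately show ?thesis
    unfolding fourier_series_def[of "\<lambda>p. fourier_series (c p) (of_real t)"]
    by (simp add: infsumI)
qed

text \<open>Multiply the Leibniz rule by the character
  \<open>exp (\<i> * l * s) * exp (\<i> * m * t)\<close> and sum over \<open>l\<close> and
  \<open>m\<close>. Each of its three terms is a convolution, so it becomes the series of
  \<open>c\<close> times the series of \<open>d\<close>, evaluated at \<open>s + t\<close>,
  \<open>s\<close> and \<open>t\<close> respectively.\<close>

lemma leibniz_fourier:
  assumes d: "exp_decaying d"
    and leibniz: "\<And>l m. (\<Sum>\<^sub>\<infinity>k. c (l - k) (m - k) * d k) =
      (\<Sum>\<^sub>\<infinity>k. c k m * d (l - k)) + (\<Sum>\<^sub>\<infinity>k. c l k * d (m - k))"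
  shows "double_fourier c s t * fourier_series d (of_real (s + t)) =
    double_fourier c s t * fourier_series d (of_real s) +
    double_fourier c s t * fourier_series d (of_real t)"
proof -
  define e :: "int \<Rightarrow> real \<Rightarrow> complex" where "e k x = exp (\<i> * of_int k * of_real x)" for k x
  let ?G = "double_fourier c s t" and ?F = "\<lambda>x. fourier_series d (of_real x)"
  have e_diff: "e (k - l) x = e k x / e l x" and e_add: "e k (x + y) = e k x * e k y"
    and e_nz: "e k x \<noteq> 0" for k l x y
    by (simp_all add: e_def algebra_simps flip: exp_add exp_diff)
  have prod: "((\<lambda>((p, q), k). (c p q * (e p s * e q t)) * (d k * e k x)) has_sum ?G * ?F x)
      ((UNIV \<times> UNIV) \<times> UNIV)" for x
    using has_sum_Times_mult[OF double_fourier_has_sum fourier_series_has_sum[OF d]]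
    by (simp add: e_def case_prod_unfold)
  \<comment> \<open>All three terms come from the family in \<open>prod\<close> by a bijection
    \<open>j\<close> of index triples with inverse \<open>i\<close>. Condition \<open>h\<close> says
    that after the substitution the characters combine to the one belonging to
    \<open>(l, m)\<close>; the sum over \<open>k\<close> is then taken first.\<close>
  have reindexed: "((\<lambda>(l, m). (\<Sum>\<^sub>\<infinity>k. h l m k) * (e l s * e m t)) has_sum ?G * ?F x) (UNIV \<times> UNIV)"
    if ij: "\<And>y. i (j y) = y" "\<And>y. j (i y) = y"
      and h: "\<And>l m k. (case j ((l, m), k) of ((p, q), n) \<Rightarrow> (c p q * (e p s * e q t)) * (d n * e n x)) =
        h l m k * (e l s * e m t)"
    for h x and i j :: "(int \<times> int) \<times> int \<Rightarrow> (int \<times> int) \<times> int"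
  proof -
    have "((\<lambda>((l, m), k). h l m k * (e l s * e m t)) has_sum ?G * ?F x) ((UNIV \<times> UNIV) \<times> UNIV)"
      by (rule has_sum_reindex_bij_witness[where i = i and j = j, THEN iffD2, OF _ _ _ _ _ refl prod])
        (use ij h in \<open>auto simp: case_prod_unfold\<close>)
    from has_sum_Times_infsum[OF this] show ?thesis
      by (simp add: case_prod_unfold infsum_cmult_left')
  qed
  \<comment> \<open>Here \<open>l = p + k\<close> and \<open>m = q + k\<close>, so the index of
    \<open>d\<close> is shifted into both variables and its character is taken at
    \<open>s + t\<close>.\<close>
  have 1: "((\<lambda>(l, m). (\<Sum>\<^sub>\<infinity>k. c (l - k) (m - k) * d k) * (e l s * e m t)) has_sum ?G * ?F (s + t))
      (UNIV \<times> UNIV)"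
    by (intro reindexed[where j = "\<lambda>((l, m), k). ((l - k, m - k), k)"
          and i = "\<lambda>((p, q), k). ((p + k, q + k), k)"])
      (auto simp: e_diff e_add e_nz)
  \<comment> \<open>Here the index of \<open>d\<close> is \<open>l - k\<close>, and the old first
    index of \<open>c\<close> becomes the inner summation variable; only \<open>s\<close> is
    affected. The third case is symmetric.\<close>
  have 2: "((\<lambda>(l, m). (\<Sum>\<^sub>\<infinity>k. c k m * d (l - k)) * (e l s * e m t)) has_sum ?G * ?F s) (UNIV \<times> UNIV)"
    by (intro reindexed[where j = "\<lambda>((l, m), k). ((k, m), l - k)"
          and i = "\<lambda>((p, q), k). ((p + k, q), p)"])
      (auto simp: e_diff e_nz)
  have 3: "((\<lambda>(l, m). (\<Sum>\<^sub>\<infinity>k. c l k * d (m - k)) * (e l s * e m t)) has_sum ?G * ?F t) (UNIV \<times> UNIV)"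
    by (intro reindexed[where j = "\<lambda>((l, m), k). ((l, k), m - k)"
          and i = "\<lambda>((p, q), k). ((p, q + k), q)"])
      (auto simp: e_diff e_nz)
  have "((\<lambda>(l, m). (\<Sum>\<^sub>\<infinity>k. c (l - k) (m - k) * d k) * (e l s * e m t)) has_sum (?G * ?F s + ?G * ?F t))
      (UNIV \<times> UNIV)"
    using has_sum_add[OF 2 3] by (simp add: leibniz case_prod_unfold distrib_right)
  with 1 show ?thesis
    by (rule has_sum_unique)
qed

lemma leibniz_imp_product_eq_0:
  assumes d: "exp_decaying d" and "m0 \<noteq> 0" "d m0 \<noteq> 0"
    and leibniz: "\<And>l m. (\<Sum>\<^sub>\<infinity>k. c (l - k) (m - k) * d k) =
      (\<Sum>\<^sub>\<infinity>k. c k m * d (l - k)) + (\<Sum>\<^sub>\<infinity>k. c l k * d (m - k))"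
  shows "c k l = 0"
proof -
  \<comment> \<open>Chosen so that its series is \<open>exp (\<i> * m0 * t) - 1\<close>, the factor
    multiplying \<open>d m0\<close> in the coefficient at \<open>m0\<close> of \<open>?b\<close>
    below. This turns the exceptional values of \<open>t\<close> into zeros of a Fourier
    series.\<close>
  let ?u = "\<lambda>m. of_bool (m = m0) - of_bool (m = 0)"
  have u_dec: "exp_decaying ?u"
    by (rule exp_decaying_finite_support[where N = "\<bar>m0\<bar>"]) auto
  have u_eq: "fourier_series ?u z = exp (\<i> * of_int m0 * z) - 1" for z
  proof -
    have "fourier_series ?u z = (\<Sum>\<^sub>\<infinity>m\<in>{m0, 0}. ?u m * exp (\<i> * of_int m * z))"
      unfolding fourier_series_def by (rule infsum_cong_neutral) auto
    also have "\<dots> = exp (\<i> * of_int m0 * z) - 1"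
      using \<open>m0 \<noteq> 0\<close> by simp
    finally show ?thesis .
  qed
  \<comment> \<open>Zero divisors in the variable \<open>s\<close>, with \<open>t\<close> fixed:
    \<open>?b\<close> has a nonzero coefficient at \<open>m0\<close>, so the coefficients of the
    other factor vanish for all \<open>p\<close>.\<close>
  have *: "fourier_series (c p) (of_real t) = 0"
    if t: "fourier_series ?u (of_real t) \<noteq> 0" for p and t :: real
  proof -
    let ?E = "\<lambda>m. exp (\<i> * of_int m * of_real t)"
    \<comment> \<open>the coefficients, in \<open>s\<close>, of \<open>d^(s + t) - d^(s) - d^(t)\<close>\<close>
    let ?b = "\<lambda>m. d m * ?E m - d m - of_bool (m = 0) * fourier_series d (of_real t)"
    have b_dec: "exp_decaying ?b"
    proof (intro exp_decaying_diff d)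
      show "exp_decaying (\<lambda>m. d m * ?E m)"
        by (rule exp_decaying_dominated[OF d, of _ 1]) (simp add: norm_mult)
      show "exp_decaying (\<lambda>m. of_bool (m = 0) * fourier_series d (of_real t))"
        by (rule exp_decaying_finite_support[where N = 0]) auto
    qed
    have b_eq: "fourier_series ?b (of_real s) = fourier_series d (of_real (s + t)) -
        fourier_series d (of_real s) - fourier_series d (of_real t)" for s :: real
    proof -
      have "((\<lambda>m. of_bool (m = 0) * fourier_series d (of_real t) * exp (\<i> * of_int m * of_real s))
          has_sum fourier_series d (of_real t)) UNIV"
        by (rule has_sum_finite_neutralI[where B = "{0}"]) auto
      from has_sum_add[OF has_sum_add[OF fourier_series_has_sum[OF d, of "s + t"]
            has_sum_uminusI[OF fourier_series_has_sum[OF d, of s]]] has_sum_uminusI[OF this]]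
      have "((\<lambda>m. ?b m * exp (\<i> * of_int m * of_real s)) has_sum
          (fourier_series d (of_real (s + t)) - fourier_series d (of_real s) -
            fourier_series d (of_real t))) UNIV"
        by (simp add: algebra_simps exp_add)
      then show ?thesis
        unfolding fourier_series_def[of ?b] by (rule infsumI)
    qed
    have "?b m0 = d m0 * (?E m0 - 1)"
      using \<open>m0 \<noteq> 0\<close> by (simp add: algebra_simps)
    then have "?b m0 \<noteq> 0"
      using t \<open>d m0 \<noteq> 0\<close> by (simp add: u_eq)
    moreover have "fourier_series (\<lambda>p. fourier_series (c p) (of_real t)) (of_real s) *
        fourier_series ?b (of_real s) = 0" for s :: real
      using leibniz_fourier[OF d leibniz, of s t]
      by (simp only: b_eq double_fourier_eq) (simp add: algebra_simps)
    ultimately show ?thesis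
      using fourier_series_no_zero_divisors[OF exp_decaying_partial_fourier b_dec] by blast
  qed
  \<comment> \<open>Zero divisors again, now in the variable \<open>t\<close> for a fixed row
    \<open>k\<close>: by \<open>*\<close>, at every real \<open>t\<close> one of the two series
    vanishes.\<close>
  have "(\<forall>l. c k l = 0) \<or> (\<forall>m. ?u m = (0::complex))"
    by (rule fourier_series_no_zero_divisors[OF exp_decaying_section u_dec]) (use * in auto)
  moreover have "?u m0 \<noteq> (0::complex)"
    using \<open>m0 \<noteq> 0\<close> by simp
  ultimately show ?thesis by blast
qed

end

theorem mainTheorem1:
  "\<not> (\<exists>(C :: int \<Rightarrow> int \<Rightarrow> int \<Rightarrow> complex) (D :: int \<Rightarrow> int \<Rightarrow> complex).
        nontrivial_product C \<and> nontrivial_difference D \<and> annihilates_constants D \<and>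
        (\<exists>c d. translation_invariant C D c d \<and> exponential_decay c d) \<and>
        leibniz_rule C D \<and> associative_law C)"
proof safe
  fix C D c d
  assume nt: "nontrivial_product C" "nontrivial_difference D" and ann: "annihilates_constants D"
    and inv: "translation_invariant C D c d" and dec: "exponential_decay c d"
    and leibniz: "leibniz_rule C D"
  have C: "C l m n = c (l - n) (m - n)" and D: "D m n = d (m - n)" for l m n
    using inv by (auto simp: translation_invariant_def)
  obtain K r where r: "r > 0"
    and c_le: "\<And>k l. norm (c k l) \<le> K * exp (- r * real_of_int (\<bar>k\<bar> + \<bar>l\<bar>))"
    and d_le: "\<And>m. norm (d m) \<le> K * exp (- r * real_of_int \<bar>m\<bar>)"
    using dec by (auto simp: exponential_decay_def)
  have d: "exp_decaying d"
    using r d_le by (auto simp: exp_decaying_def)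
  \<comment> \<open>By translation invariance the output site may be taken to be 0.\<close>
  have "(\<Sum>\<^sub>\<infinity>k. c (l - k) (m - k) * d k) =
      (\<Sum>\<^sub>\<infinity>k. c k m * d (l - k)) + (\<Sum>\<^sub>\<infinity>k. c l k * d (m - k))" for l m
    using leibniz[unfolded leibniz_rule_def, rule_format, of l m 0] by (simp add: C D)
  \<comment> \<open>A nonzero \<open>d m\<close> away from 0 would force \<open>c = 0\<close>,
    against the nontriviality of the product.\<close>
  from leibniz_imp_product_eq_0[OF r c_le d _ _ this] have d0: "d m = 0" if "m \<noteq> 0" for m
    using nt(1) that by (auto simp: nontrivial_product_def C)
  have "(d has_sum d 0) UNIV"
    by (rule has_sum_finite_neutralI[where B = "{0}"]) (auto intro: d0)
  moreover have "(d has_sum 0) UNIV"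
    using ann by (auto simp: annihilates_constants_def D dest: spec[of _ 0])
  ultimately have "d 0 = 0"
    by (rule has_sum_unique)
  with d0 nt(2) show False
    by (metis nontrivial_difference_def D)
qed

end
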